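(* Let $T$ and $T'$ be two tournaments on the same set $V$ of $v$ vertices. Let $p$ be a prime number and $k$ an integer with $3\leq k\leq v-3$. 1) If $c^{(3)}(T_{\restriction K})=c^{(3)}(T'_{\restriction K})$ for all $k$-element subsets $K$ of $V$, then $T$ and $T'$ are $(\leq 3)$-hypomorphic. 2) Assume $p\geq 5$. If $k\not\equiv 1,2 \pmod p$ and $c^{(3)}(T_{\restriction K})\equiv c^{(3)}(T'_{\restriction K}) \pmod p$ for all $k$-element subsets $K$ of $V$, then $T$ and $T'$ are $(\leq 3)$-hypomorphic. 3) If ($p=2$ and $k\equiv 3\pmod 4$) or ($p=3$ and $3\mid k$), and $c^{(3)}(T_{\restriction K})\equiv c^{(3)}(T'_{\restriction K}) \pmod p$ for all $k$-element subsets $K$ of $V$, then $T$ and $T'$ are $(\leq 3)$-hypomorphic.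
   Context: Tournaments: for distinct vertices $x,y$ exactly one of the arcs $(x,y),(y,x)$ is present. $T_{\restriction K}$ is the induced subtournament on $K$. A $3$-cycle is a tournament isomorphic to $(\{0,1,2\},\{(0,1),(1,2),(2,0)\})$. $c^{(3)}(T)$ is the number of $3$-element vertex subsets inducing a $3$-cycle in $T$. Tournaments $T,T'$ on the same set $V$ are $h$-hypomorphic if for every $h$-element subset $K$ of $V$, $T_{\restriction K}$ and $T'_{\restriction K}$ are isomorphic; they are $(\leq k)$-hypomorphic if they are $h$-hypomorphic for every $h\leq k$. *)

theory Defs
  imports "Graph_Theory.Graph_Theory" "HOL-Number_Theory.Cong"
begin

text \<open>Finiteness is not part of the notion of a tournament.\<close>

locale tournament = pair_loopfree_digraph T for T :: "'a pair_pre_digraph" +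
  assumes exactly_one_arc:
    "\<lbrakk>x \<in> pverts T; y \<in> pverts T; x \<noteq> y\<rbrakk> \<Longrightarrow> ((x, y) \<in> parcs T) \<noteq> ((y, x) \<in> parcs T)"

definition three_cycle :: "nat pair_pre_digraph" where
  "three_cycle = \<lparr>pverts = {0, 1, 2}, parcs = {(0, 1), (1, 2), (2, 0)}\<rparr>"

definition c3 :: "('a, 'b) pre_digraph \<Rightarrow> nat" where
  "c3 G = card {X. X \<subseteq> verts G \<and> card X = 3 \<and> digraph_iso (G \<restriction> X) (with_proj three_cycle)}"

text \<open>In the next two definitions both digraphs are meant to have the vertex set \<open>V\<close>.
  Infinite subsets, which have \<open>card K = 0\<close>, are excluded explicitly.\<close>

definition hypomorphic ::
    "'a set \<Rightarrow> nat \<Rightarrow> 'a pair_pre_digraph \<Rightarrow> 'a pair_pre_digraph \<Rightarrow> bool" where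
  "hypomorphic V h T T' \<longleftrightarrow>
    (\<forall>K \<subseteq> V. finite K \<and> card K = h \<longrightarrow> digraph_iso (with_proj T \<restriction> K) (with_proj T' \<restriction> K))"

definition le_hypomorphic ::
    "'a set \<Rightarrow> nat \<Rightarrow> 'a pair_pre_digraph \<Rightarrow> 'a pair_pre_digraph \<Rightarrow> bool" where
  "le_hypomorphic V k T T' \<longleftrightarrow> (\<forall>h \<le> k. hypomorphic V h T T')"

text \<open>The library relation \<^const>\<open>digraph_iso\<close> also transports the arcs and the tail and head
  functions. For digraphs whose arcs are ordered pairs it is the usual notion: a bijection of the
  vertex sets that preserves and reflects arcs.\<close>

lemma digraph_iso_with_proj_iff:
  assumes "pair_wf_digraph G" "pair_wf_digraph H"
  shows "digraph_iso (with_proj G) (with_proj H) \<longleftrightarrow>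
    (\<exists>f. bij_betw f (pverts G) (pverts H) \<and>
      (\<forall>x\<in>pverts G. \<forall>y\<in>pverts G. (x, y) \<in> parcs G \<longleftrightarrow> (f x, f y) \<in> parcs H))"
    (is "?L \<longleftrightarrow> ?R")
proof
  interpret G: pair_wf_digraph G by fact
  assume ?L
  then obtain h where h: "pre_digraph.digraph_isomorphism (with_proj G) h"
    and H: "with_proj H = app_iso h (with_proj G)"
    unfolding digraph_iso_def by blast
  let ?f = "iso_verts h"
  have eqs: "pverts H = ?f ` pverts G" "parcs H = iso_arcs h ` parcs G"
      "iso_tail h = fst" "iso_head h = snd"
    using H unfolding with_proj_def app_iso_def by auto
  have inj: "inj_on ?f (pverts G)"
    and ends: "\<And>a. a \<in> parcs G \<Longrightarrow> iso_arcs h a = (?f (fst a), ?f (snd a))"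
    using h eqs unfolding pre_digraph.digraph_isomorphism_def by (auto simp: prod_eq_iff)
  have arcs: "parcs H = (\<lambda>a. (?f (fst a), ?f (snd a))) ` parcs G"
    using eqs(2) ends by auto
  have "(x, y) \<in> parcs G \<longleftrightarrow> (?f x, ?f y) \<in> parcs H"
    if "x \<in> pverts G" "y \<in> pverts G" for x y
  proof
    assume "(x, y) \<in> parcs G"
    then show "(?f x, ?f y) \<in> parcs H" unfolding arcs by (rule rev_image_eqI) simp
  next
    assume "(?f x, ?f y) \<in> parcs H"
    then obtain u w where uw: "(u, w) \<in> parcs G" "?f x = ?f u" "?f y = ?f w"
      unfolding arcs by auto
    then have "x = u" "y = w"
      using inj_onD[OF inj] that G.in_arcsD1 G.in_arcsD2 by blast+
    then show "(x, y) \<in> parcs G" using uw(1) by simp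
  qed
  then show ?R using inj eqs(1) unfolding bij_betw_def by blast
next
  interpret G: pair_wf_digraph G by fact
  interpret H: pair_wf_digraph H by fact
  assume ?R
  then obtain f where f: "bij_betw f (pverts G) (pverts H)"
    and arc: "\<And>x y. x \<in> pverts G \<Longrightarrow> y \<in> pverts G \<Longrightarrow> (x, y) \<in> parcs G \<longleftrightarrow> (f x, f y) \<in> parcs H"
    by blast
  let ?h = "\<lparr>iso_verts = f, iso_arcs = map_prod f f, iso_head = snd, iso_tail = fst\<rparr>"
  have inj: "inj_on f (pverts G)" and img: "f ` pverts G = pverts H"
    using f by (auto simp: bij_betw_def)
  have "map_prod f f ` parcs G = parcs H"
  proof (intro equalityI subsetI)
    fix e assume "e \<in> map_prod f f ` parcs G"
    then show "e \<in> parcs H" using arc by (auto dest: G.in_arcsD1 G.in_arcsD2)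
  next
    fix e assume e: "e \<in> parcs H"
    obtain u v where uv: "e = (u, v)" by (cases e)
    then obtain x y where "x \<in> pverts G" "y \<in> pverts G" "u = f x" "v = f y"
      using e H.in_arcsD1 H.in_arcsD2 img by blast
    then show "e \<in> map_prod f f ` parcs G" using arc e uv by force
  qed
  then have "with_proj H = app_iso ?h (with_proj G)"
    using img unfolding with_proj_def app_iso_def by simp
  moreover have "inj_on (map_prod f f) (parcs G)"
    by (rule inj_on_subset[OF map_prod_inj_on[OF inj inj]])
       (auto dest: G.in_arcsD1 G.in_arcsD2)
  then have "pre_digraph.digraph_isomorphism (with_proj G) ?h"
    using inj G.wf_digraph unfolding pre_digraph.digraph_isomorphism_def by auto
  ultimately show ?L unfolding digraph_iso_def by blast
qed

end

theory Submission
  imports Defs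
begin

text \<open>
  Let \<open>g X\<close> be the indicator of ``\<open>X\<close> is cyclic in \<open>T\<close>'' minus that for \<open>T'\<close>, so that \<open>g\<close> sums to
  \<open>0\<close> over the triples of each \<open>k\<close>-set. Replacing \<open>a\<close> by \<open>b\<close> in a \<open>k\<close>-set shows that the discrete
  derivative \<open>g (insert a Z) - g (insert b Z)\<close> has the same property on \<open>V - {a, b}\<close> with \<open>k - 1\<close>
  and \<open>2\<close> in place of \<open>k\<close> and \<open>3\<close>. Iterating, the derivatives vanish modulo \<open>p\<close> as soon as \<open>p\<close>
  divides neither \<open>k - 2\<close> nor \<open>(k - 1) choose 2\<close>; hence \<open>g\<close> is constant modulo \<open>p\<close>. For \<open>p \<ge> 3\<close> it is then constant as a
  \<open>{-1, 0, 1}\<close>-valued function, and it must be \<open>0\<close> since no tournament on at least four vertices has only cyclic triples;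
  for \<open>p = 2\<close> it is \<open>0\<close> because \<open>k choose 3\<close> is odd. The first part is the second one for a prime
  larger than \<open>k\<close>.
\<close>

section \<open>Sums over the \<open>t\<close>-subsets of \<open>k\<close>-sets modulo
  \<open>m\<close>\<close>

text \<open>Any two \<open>t\<close>-subsets are joined by a chain of single-element exchanges, each
  bringing \<open>X\<close> closer to \<open>Y\<close>, so invariance under one exchange propagates
  by transitivity.\<close>

lemma exchange_cong_imp_cong:
  fixes g :: "'a set \<Rightarrow> int" and m :: int
  assumes "finite V"
    and exchange: "\<And>a b Z. a \<in> V \<Longrightarrow> b \<in> V \<Longrightarrow> a \<noteq> b \<Longrightarrow> Z \<subseteq> V - {a, b} \<Longrightarrow> Suc (card Z) = t \<Longrightarrow>
      [g (insert a Z) = g (insert b Z)] (mod m)"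
    and "X \<subseteq> V" "Y \<subseteq> V" "card X = t" "card Y = t"
  shows "[g X = g Y] (mod m)"
  using assms(3,5)
proof (induction "card (X - Y)" arbitrary: X)
  case 0
  have "finite X" "finite Y"
    using 0 assms finite_subset by blast+
  then have "X = Y"
    using 0 assms by (metis card_0_eq card_subset_eq finite_Diff Diff_eq_empty_iff)
  then show ?case by simp
next
  case (Suc n)
  have fin: "finite X" "finite Y"
    using Suc assms finite_subset by blast+
  have ne: "X - Y \<noteq> {}"
    using Suc.hyps(2) by (metis card.empty nat.distinct(1))
  \<comment> \<open>Equal cardinalities make \<open>Y - X\<close> nonempty as well, which supplies
    the element \<open>b\<close> to swap in for \<open>a\<close>.\<close>
  then have "\<not> Y \<subseteq> X"
    using fin Suc.prems assms(6) by (metis Diff_cancel card_subset_eq)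
  with ne obtain a b where ab: "a \<in> X" "a \<notin> Y" "b \<in> Y" "b \<notin> X" by blast
  let ?Z = "X - {a}"
  have Z: "?Z \<subseteq> V - {a, b}" "Suc (card ?Z) = t" "insert a ?Z = X"
    using ab Suc.prems card_Suc_Diff1[OF fin(1) ab(1)] by auto
  have "insert b ?Z - Y = (X - Y) - {a}" using ab by auto
  then have "card (insert b ?Z - Y) = n"
    using Suc.hyps(2) ab fin by simp
  moreover have "insert b ?Z \<subseteq> V" "card (insert b ?Z) = t"
    using Z ab assms fin by auto
  ultimately have "[g (insert b ?Z) = g Y] (mod m)"
    using Suc.hyps(1) by metis
  moreover have "[g X = g (insert b ?Z)] (mod m)"
    using exchange[of a b ?Z] Z ab Suc.prems assms(4) by (metis subsetD)
  ultimately show ?case by (rule cong_trans[rotated])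
qed

text \<open>Pascal's rule for sums: the subsets split according to whether they contain
  \<open>a\<close>, and removing \<open>a\<close> reindexes the second class.\<close>

lemma sum_subsets_insert:
  fixes g :: "'a set \<Rightarrow> 'b :: comm_monoid_add"
  assumes "finite S" "a \<notin> S"
  shows "(\<Sum>X | X \<subseteq> insert a S \<and> card X = Suc t. g X) =
    (\<Sum>X | X \<subseteq> S \<and> card X = Suc t. g X) + (\<Sum>X | X \<subseteq> S \<and> card X = t. g (insert a X))"
proof -
  let ?A = "{X. X \<subseteq> S \<and> card X = Suc t}" and ?B = "{X. X \<subseteq> S \<and> card X = t}"
  have "{X. X \<subseteq> insert a S \<and> card X = Suc t} = ?A \<union> insert a ` ?B" (is "?L = ?R")
  proof (intro equalityI subsetI)
    fix X assume X: "X \<in> ?L"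
    then have fX: "finite X" using assms finite_subset by blast
    show "X \<in> ?R"
    proof (cases "a \<in> X")
      case True
      then have "X = insert a (X - {a})" by auto
      moreover have "X - {a} \<in> ?B" using X True fX by auto
      ultimately show ?thesis by blast
    qed (use X in auto)
  next
    fix X assume "X \<in> ?R"
    moreover have "card (insert a Y) = Suc t" if "Y \<in> ?B" for Y
      using that assms finite_subset[of Y S] by (subst card_insert_disjoint) auto
    ultimately show "X \<in> ?L" by auto
  qed
  moreover have "inj_on (insert a) ?B"
    using assms by (intro inj_onI) (metis insert_ident mem_Collect_eq subsetD)
  moreover have "?A \<inter> insert a ` ?B = {}"
    using assms by auto
  moreover have "finite ?A" "finite ?B"
    using assms by (auto intro: finite_subset[of _ "Pow S"])
  ultimately show ?thesis
    by (simp add: sum.union_disjoint sum.reindex)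
qed

text \<open>The sets \<open>insert a S\<close> and \<open>insert b S\<close> share the subsets lying
  inside \<open>S\<close>. Subtracting their two sums cancels these and leaves the derivative of
  \<open>g\<close>.\<close>

lemma subset_sums_exchange:
  fixes g :: "'a set \<Rightarrow> int" and m :: int
  assumes "finite V" "a \<in> V" "b \<in> V" "a \<noteq> b"
    and sums: "\<And>K. K \<subseteq> V \<Longrightarrow> card K = Suc k \<Longrightarrow>
      [(\<Sum>X | X \<subseteq> K \<and> card X = Suc t. g X) = 0] (mod m)"
    and "S \<subseteq> V - {a, b}" "card S = k"
  shows "[(\<Sum>X | X \<subseteq> S \<and> card X = t. g (insert a X) - g (insert b X)) = 0] (mod m)"
proof -
  have S: "finite S" "a \<notin> S" "b \<notin> S"
    using assms finite_subset[OF assms(6)] by auto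
  let ?F = "\<lambda>K. \<Sum>X | X \<subseteq> K \<and> card X = Suc t. g X"
  have "[?F (insert a S) - ?F (insert b S) = 0 - 0] (mod m)"
    using assms S by (intro cong_diff sums) auto
  then show ?thesis
    using S by (simp add: sum_subsets_insert sum_subtractf)
qed

text \<open>The nonsingular case of Wilson's theorem on the rank of inclusion matrices.\<close>

lemma subset_sums_cong_0:
  fixes g :: "'a set \<Rightarrow> int" and m :: int
  assumes "finite V" "t \<le> k" "k + t \<le> card V"
    and "\<And>i. i \<le> t \<Longrightarrow> coprime (int ((k - i) choose (t - i))) m"
    and "\<And>K. K \<subseteq> V \<Longrightarrow> card K = k \<Longrightarrow> [(\<Sum>X | X \<subseteq> K \<and> card X = t. g X) = 0] (mod m)"
    and "X \<subseteq> V" "card X = t"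
  shows "[g X = 0] (mod m)"
  using assms
\<comment> \<open>The induction hypothesis is applied to the derivative of \<open>g\<close>, which
  lives on a smaller \<open>V\<close> with a smaller \<open>k\<close>; hence the
  generalisation.\<close>
proof (induction t arbitrary: V k g X)
  case 0
  obtain K where K: "K \<subseteq> V" "card K = k"
    using 0 by (metis add.right_neutral obtain_subset_with_card_n)
  then have "finite K" using 0 finite_subset by blast
  then have "{X. X \<subseteq> K \<and> card X = 0} = {{}}"
    using finite_subset[OF _ \<open>finite K\<close>] by auto
  moreover have "X = {}"
    using 0 finite_subset by (metis card_0_eq)
  ultimately show ?case
    using "0.prems"(5)[OF K] by simp
next
  case (Suc t)
  then obtain k' where k: "k = Suc k'" by (cases k) auto
  have ex: "[g (insert a Z) = g (insert b Z)] (mod m)"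
    if ab: "a \<in> V" "b \<in> V" "a \<noteq> b" and Z: "Z \<subseteq> V - {a, b}" "Suc (card Z) = Suc t" for a b Z
  proof -
    have "[g (insert a Z) - g (insert b Z) = 0] (mod m)"
    proof (rule Suc.IH[where V = "V - {a, b}" and k = k' and X = Z
          and g = "\<lambda>Z. g (insert a Z) - g (insert b Z)"])
      \<comment> \<open>Lowering both \<open>k\<close> and \<open>t\<close> by one shifts the index:
        the binomial at \<open>i\<close> here is the original one at \<open>i + 1\<close>.\<close>
      show "coprime (int ((k' - i) choose (t - i))) m" if "i \<le> t" for i
        using Suc.prems(4)[of "Suc i"] that k by simp
      \<comment> \<open>Two points leave \<open>V\<close>, while \<open>k\<close> and
        \<open>t\<close> drop by one each.\<close>
      show "k' + t \<le> card (V - {a, b})"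
        using Suc.prems(1,3) ab k by (simp add: card_Diff_subset)
    qed (use Suc.prems k ab Z subset_sums_exchange[where V = V and g = g and m = m and k = k' and t = t] in auto)
    then show ?thesis by (simp add: cong_diff_iff_cong_0)
  qed
  obtain K where K: "K \<subseteq> V" "card K = k"
    using Suc.prems by (metis add_leD1 obtain_subset_with_card_n)
  have fK: "finite K" using K Suc.prems finite_subset by blast
  let ?N = "{Y. Y \<subseteq> K \<and> card Y = Suc t}"
  \<comment> \<open>By \<open>ex\<close>, \<open>g\<close> is constant modulo \<open>m\<close>, so
    the sum over one \<open>k\<close>-set is a binomial coefficient times \<open>g X\<close>; the
    coefficient is invertible by the case \<open>i = 0\<close>.\<close>
  have "[(\<Sum>Y\<in>?N. g X) = (\<Sum>Y\<in>?N. g Y)] (mod m)"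
    using Suc.prems K by (intro cong_sum exchange_cong_imp_cong[where g = g, OF _ ex]) auto
  also have "[(\<Sum>Y\<in>?N. g Y) = 0] (mod m)"
    using Suc.prems K by blast
  finally have "[int (k choose Suc t) * g X = int (k choose Suc t) * 0] (mod m)"
    using fK K by (simp add: n_subsets)
  moreover have "coprime (int (k choose Suc t)) m"
    using Suc.prems(4)[of 0] by simp
  ultimately show ?case
    using cong_mult_lcancel by blast
qed

text \<open>The derivatives of \<open>g\<close> vanish by the previous lemma. Stopping before the
  division by \<open>k choose t\<close> gives constancy only, so the coprimality range starts at
  \<open>i = 1\<close>. This matters because \<open>k choose 3\<close> is divisible by every prime
  \<open>p \<ge> 5\<close> that divides \<open>k\<close>.\<close>

lemma subset_sums_cong_const:
  fixes g :: "'a set \<Rightarrow> int" and m :: int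
  assumes "finite V" "t \<le> k" "k + t \<le> card V"
    and "\<And>i. 1 \<le> i \<Longrightarrow> i \<le> t \<Longrightarrow> coprime (int ((k - i) choose (t - i))) m"
    and "\<And>K. K \<subseteq> V \<Longrightarrow> card K = k \<Longrightarrow> [(\<Sum>X | X \<subseteq> K \<and> card X = t. g X) = 0] (mod m)"
    and "X \<subseteq> V" "Y \<subseteq> V" "card X = t" "card Y = t"
  shows "[g X = g Y] (mod m)"
proof (rule exchange_cong_imp_cong[OF assms(1) _ assms(6-9)])
  fix a b Z
  assume ab: "a \<in> V" "b \<in> V" "a \<noteq> b" and Z: "Z \<subseteq> V - {a, b}" "Suc (card Z) = t"
  obtain k' where k: "k = Suc k'" using Z assms(2) by (cases k) auto
  have "[g (insert a Z) - g (insert b Z) = 0] (mod m)"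
  proof (rule subset_sums_cong_0[where V = "V - {a, b}" and k = k' and t = "card Z" and X = Z
        and g = "\<lambda>Z. g (insert a Z) - g (insert b Z)"])
    show "coprime (int ((k' - i) choose (card Z - i))) m" if "i \<le> card Z" for i
      using assms(4)[of "Suc i"] that k Z(2) by auto
    show "k' + card Z \<le> card (V - {a, b})"
      using assms(1,3) ab k Z by (simp add: card_Diff_subset)
  qed (use assms k ab Z subset_sums_exchange[where V = V and g = g and m = m and k = k' and t = "card Z"] in auto)
  then show "[g (insert a Z) = g (insert b Z)] (mod m)" by (simp add: cong_diff_iff_cong_0)
qed

section \<open>Isomorphisms of induced subdigraphs\<close>

lemma induce_subgraph_with_proj:
  "with_proj G \<restriction> K =
    with_proj \<lparr>pverts = K, parcs = {e \<in> parcs G. fst e \<in> K \<and> snd e \<in> K}\<rparr>"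
  by (simp add: induce_subgraph_def with_proj_def)

text \<open>Inducing keeps only arcs with both ends in the chosen set, so both sides are well formed
  and the characterisation of \<open>digraph_iso\<close> by vertex bijections applies.\<close>

lemma digraph_iso_induce_subgraph_iff:
  "digraph_iso (with_proj G \<restriction> K) (with_proj H \<restriction> L) \<longleftrightarrow>
    (\<exists>f. bij_betw f K L \<and> (\<forall>x\<in>K. \<forall>y\<in>K. (x, y) \<in> parcs G \<longleftrightarrow> (f x, f y) \<in> parcs H))"
  unfolding induce_subgraph_with_proj
  by (subst digraph_iso_with_proj_iff) (unfold_locales, auto simp: bij_betw_def)

text \<open>Each triple is listed along a directed path, so only the arc between its ends remains
  open. The last assumption covers the cyclic and the transitive case together; the isomorphism
  matches the listings.\<close>

lemma digraph_iso_triple: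
  assumes "asym (parcs G)" "asym (parcs H)" "distinct [x, y, z]" "distinct [x', y', z']"
    and "(x, y) \<in> parcs G" "(x', y') \<in> parcs H" "(y, z) \<in> parcs G" "(y', z') \<in> parcs H"
    and "(z, x) \<in> parcs G \<and> (z', x') \<in> parcs H \<or> (x, z) \<in> parcs G \<and> (x', z') \<in> parcs H"
  shows "digraph_iso (with_proj G \<restriction> {x, y, z}) (with_proj H \<restriction> {x', y', z'})"
proof -
  define f where "f = (\<lambda>u. if u = x then x' else if u = y then y' else z')"
  have "bij_betw f {x, y, z} {x', y', z'}"
    using assms(3,4) by (auto simp: f_def bij_betw_def inj_on_def)
  moreover have "(u, v) \<in> parcs G \<longleftrightarrow> (f u, f v) \<in> parcs H"
    if "u \<in> {x, y, z}" "v \<in> {x, y, z}" for u v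
  proof -
    have f: "f x = x'" "f y = y'" "f z = z'"
      using assms(3) by (auto simp: f_def)
    have irrefl: "(w, w) \<notin> parcs G" "(w', w') \<notin> parcs H" for w w'
      using asymD[OF assms(1)] asymD[OF assms(2)] by blast+
    have neg: "(y, x) \<notin> parcs G" "(z, y) \<notin> parcs G" "(y', x') \<notin> parcs H" "(z', y') \<notin> parcs H"
      using assms(5-8) asymD[OF assms(1)] asymD[OF assms(2)] by blast+
    have third: "(z, x) \<in> parcs G \<longleftrightarrow> (z', x') \<in> parcs H" "(x, z) \<in> parcs G \<longleftrightarrow> (x', z') \<in> parcs H"
      using assms(9) asymD[OF assms(1)] asymD[OF assms(2)] by blast+
    show ?thesis
      using that by (elim insertE emptyE) (simp_all add: f irrefl neg third assms(5-8))
  qed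
  ultimately show ?thesis
    unfolding digraph_iso_induce_subgraph_iff by blast
qed

text \<open>Writing the 3-cycle as an induced subdigraph of itself makes
  \<open>digraph_iso_induce_subgraph_iff\<close> applicable to it.\<close>

lemma three_cycle_induce: "with_proj three_cycle = with_proj three_cycle \<restriction> {0, 1, 2}"
  by (auto simp: three_cycle_def induce_subgraph_def with_proj_def)

section \<open>Cyclic and transitive triples of a tournament\<close>

definition cyclic_triple :: "'a pair_pre_digraph \<Rightarrow> 'a set \<Rightarrow> bool" where
  "cyclic_triple T X \<longleftrightarrow> digraph_iso (with_proj T \<restriction> X) (with_proj three_cycle)"

text \<open>Inducing on \<open>K\<close> and then on \<open>X \<subseteq> K\<close> is inducing on
  \<open>X\<close>, so the summand is independent of \<open>K\<close>. The integer-valued sum has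
  the shape required by the results on subset sums.\<close>

lemma c3_induce:
  assumes "finite K"
  shows "int (c3 (with_proj T \<restriction> K)) = (\<Sum>X | X \<subseteq> K \<and> card X = 3. of_bool (cyclic_triple T X))"
proof -
  have "(with_proj T \<restriction> K) \<restriction> X = with_proj T \<restriction> X" if "X \<subseteq> K" for X
    using that by (auto simp: induce_subgraph_def)
  then have "{X. X \<subseteq> K \<and> card X = 3 \<and> digraph_iso ((with_proj T \<restriction> K) \<restriction> X) (with_proj three_cycle)}
      = {X. X \<subseteq> K \<and> card X = 3} \<inter> {X. cyclic_triple T X}"
    unfolding cyclic_triple_def by auto
  moreover have "finite {X. X \<subseteq> K \<and> card X = 3}"
    using assms by (auto intro: finite_subset[of _ "Pow K"])
  ultimately show ?thesis
    by (simp add: c3_def of_bool_def sum.If_cases)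
qed

context tournament
begin

lemma asym_parcs: "asym (parcs T)"
proof (rule asymI)
  fix x y assume xy: "(x, y) \<in> parcs T"
  then show "(y, x) \<notin> parcs T"
    using exactly_one_arc[of x y] pair_no_loops[OF xy] in_arcsD1 in_arcsD2 by auto
qed

lemma cyclic_triple_iff:
  "cyclic_triple T X \<longleftrightarrow>
    (\<exists>x y z. X = {x, y, z} \<and> (x, y) \<in> parcs T \<and> (y, z) \<in> parcs T \<and> (z, x) \<in> parcs T)"
proof
  assume "cyclic_triple T X"
  then have "digraph_iso (with_proj T \<restriction> X) (with_proj three_cycle \<restriction> {0, 1, 2})"
    unfolding cyclic_triple_def by (subst (asm) three_cycle_induce)
  then obtain f where f: "bij_betw f X {0, 1, 2}"
    and arc: "\<And>x y. x \<in> X \<Longrightarrow> y \<in> X \<Longrightarrow> (x, y) \<in> parcs T \<longleftrightarrow> (f x, f y) \<in> parcs three_cycle"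
    unfolding digraph_iso_induce_subgraph_iff by blast
  have img: "f ` X = {0, 1, 2}" and inj: "inj_on f X" using f by (auto simp: bij_betw_def)
  \<comment> \<open>The preimages of \<open>0\<close>, \<open>1\<close>, \<open>2\<close> list
    \<open>X\<close> in cyclic order.\<close>
  obtain x y z where xyz: "x \<in> X" "y \<in> X" "z \<in> X" "f x = 0" "f y = 1" "f z = 2"
    using img by (metis imageE insertI1 insertI2)
  have "f ` X = f ` {x, y, z}" using img xyz by auto
  then have "X = {x, y, z}" using inj xyz by (subst (asm) inj_on_image_eq_iff[OF inj]) auto
  then show "\<exists>x y z. X = {x, y, z} \<and> (x, y) \<in> parcs T \<and> (y, z) \<in> parcs T \<and> (z, x) \<in> parcs T"
    using arc xyz by (intro exI[of _ x] exI[of _ y] exI[of _ z]) (simp add: three_cycle_def)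
next
  assume "\<exists>x y z. X = {x, y, z} \<and> (x, y) \<in> parcs T \<and> (y, z) \<in> parcs T \<and> (z, x) \<in> parcs T"
  then obtain x y z where X: "X = {x, y, z}"
    and arcs: "(x, y) \<in> parcs T" "(y, z) \<in> parcs T" "(z, x) \<in> parcs T" by blast
  have "distinct [x, y, z]" using arcs asym_parcs by (auto dest: asymD)
  moreover have "asym (parcs three_cycle)" by (auto simp: three_cycle_def asym_iff)
  ultimately have "digraph_iso (with_proj T \<restriction> {x, y, z}) (with_proj three_cycle \<restriction> {0, 1, 2})"
    using arcs asym_parcs by (intro digraph_iso_triple) (auto simp: three_cycle_def)
  then show "cyclic_triple T X" unfolding cyclic_triple_def X by (subst three_cycle_induce)
qed

text \<open>Of the eight orientations of a triangle two are cyclic; the other six are the linear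
  orders of its vertices, one per case below.\<close>

lemma transitive_tripleE:
  assumes "X \<subseteq> pverts T" "card X = 3" "\<not> cyclic_triple T X"
  obtains x y z where "X = {x, y, z}" "distinct [x, y, z]"
    "(x, y) \<in> parcs T" "(y, z) \<in> parcs T" "(x, z) \<in> parcs T"
proof -
  obtain x y z where X: "X = {x, y, z}" and d: "x \<noteq> y" "y \<noteq> z" "x \<noteq> z"
    using assms(2) by (auto simp: card_3_iff)
  let ?A = "parcs T"
  have "\<not> ((x, y) \<in> ?A \<and> (y, z) \<in> ?A \<and> (z, x) \<in> ?A)"
    using assms(3) unfolding cyclic_triple_iff X by blast
  moreover have "\<not> ((x, z) \<in> ?A \<and> (z, y) \<in> ?A \<and> (y, x) \<in> ?A)"
    using assms(3) unfolding cyclic_triple_iff X insert_commute[of y z] by blast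
  moreover have "x \<in> pverts T" "y \<in> pverts T" "z \<in> pverts T"
    using assms(1) X by auto
  then have "(x, y) \<in> ?A \<or> (y, x) \<in> ?A" "(y, z) \<in> ?A \<or> (z, y) \<in> ?A" "(x, z) \<in> ?A \<or> (z, x) \<in> ?A"
    using exactly_one_arc d by blast+
  ultimately consider
      "(x, y) \<in> ?A" "(y, z) \<in> ?A" "(x, z) \<in> ?A" | "(x, z) \<in> ?A" "(z, y) \<in> ?A" "(x, y) \<in> ?A"
    | "(y, x) \<in> ?A" "(x, z) \<in> ?A" "(y, z) \<in> ?A" | "(y, z) \<in> ?A" "(z, x) \<in> ?A" "(y, x) \<in> ?A"
    | "(z, x) \<in> ?A" "(x, y) \<in> ?A" "(z, y) \<in> ?A" | "(z, y) \<in> ?A" "(y, x) \<in> ?A" "(z, x) \<in> ?A"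
    by blast
  then show ?thesis
  proof cases
    case 1 then show ?thesis using that[of x y z] X d by auto
  next
    case 2 then show ?thesis using that[of x z y] X d by auto
  next
    case 3 then show ?thesis using that[of y x z] X d by auto
  next
    case 4 then show ?thesis using that[of y z x] X d by auto
  next
    case 5 then show ?thesis using that[of z x y] X d by auto
  next
    case 6 then show ?thesis using that[of z y x] X d by auto
  qed
qed

text \<open>A triangle has two cyclic orientations, and the arc from \<open>x\<close> to
  \<open>y\<close> selects one of them.\<close>

lemma cyclic_tripleD:
  assumes "cyclic_triple T {x, y, z}" "(x, y) \<in> parcs T" "z \<noteq> x" "z \<noteq> y"
  shows "(y, z) \<in> parcs T \<and> (z, x) \<in> parcs T"
proof -
  obtain u v w where eq: "{x, y, z} = {u, v, w}"
    and arcs: "(u, v) \<in> parcs T" "(v, w) \<in> parcs T" "(w, u) \<in> parcs T"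
    using assms(1) unfolding cyclic_triple_iff by blast
  have xy: "x \<noteq> y" "(y, x) \<notin> parcs T"
    using assms(2) asym_parcs by (auto dest: asymD)
  have "x \<in> {u, v, w}" "y \<in> {u, v, w}" "z \<in> {u, v, w}"
    using eq by blast+
  then show ?thesis
    using arcs xy assms(3,4) by auto
qed

text \<open>If all triples were cyclic, an arc from \<open>x\<close> to \<open>y\<close> would force
  arcs from \<open>y\<close> to every other vertex. With two such vertices \<open>z\<close> and
  \<open>w\<close>, the triple of \<open>y\<close>, \<open>z\<close>, \<open>w\<close> cannot be
  cyclic.\<close>

lemma exists_noncyclic_triple:
  assumes "4 \<le> card (pverts T)"
  shows "\<exists>X \<subseteq> pverts T. card X = 3 \<and> \<not> cyclic_triple T X"
proof (rule ccontr)
  assume contra: "\<not> ?thesis"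
  have next_arc: "(y, z) \<in> parcs T" "(z, x) \<in> parcs T"
    if "(x, y) \<in> parcs T" "z \<in> pverts T" "z \<noteq> x" "z \<noteq> y" for x y z
  proof -
    have "x \<noteq> y" "{x, y, z} \<subseteq> pverts T"
      using that pair_no_loops[OF that(1)] in_arcsD1 in_arcsD2 by auto
    moreover from this have "card {x, y, z} = 3"
      using that by simp
    ultimately have "cyclic_triple T {x, y, z}"
      using contra by blast
    then show "(y, z) \<in> parcs T" "(z, x) \<in> parcs T"
      using cyclic_tripleD that by blast+
  qed
  have no4: False if "(x, y) \<in> parcs T" "z \<in> pverts T" "w \<in> pverts T" "distinct [x, y, z, w]" for x y z w
  proof -
    have "(y, z) \<in> parcs T" "(y, w) \<in> parcs T"
      using that by (auto intro: next_arc(1)[OF that(1)])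
    then show False
      using next_arc(2)[of y z w] that asym_parcs by (auto dest: asymD)
  qed
  obtain S where S: "S \<subseteq> pverts T" "card S = 4"
    using assms obtain_subset_with_card_n by metis
  then obtain x y z w where "S = {x, y, z, w}" "distinct [x, y, z, w]"
    by (auto simp: numeral_eq_Suc card_Suc_eq)
  \<comment> \<open>One of the two orders of \<open>x\<close> and \<open>y\<close> starts with an
    arc, as \<open>no4\<close> requires.\<close>
  then show False
    using S no4[of x y z w] no4[of y x z w] exactly_one_arc[of x y] by auto
qed

end

section \<open>From cyclic triples to hypomorphy\<close>

text \<open>Up to isomorphism there is one tournament on each of 0, 1 and 2 vertices, and there are
  two on 3 vertices: the cyclic and the transitive one.\<close>

lemma le_3_hypomorphicI:
  assumes "tournament T" "tournament T'" "pverts T = V" "pverts T' = V"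
    and cyclic: "\<And>X. X \<subseteq> V \<Longrightarrow> card X = 3 \<Longrightarrow> cyclic_triple T X \<longleftrightarrow> cyclic_triple T' X"
  shows "le_hypomorphic V 3 T T'"
  unfolding le_hypomorphic_def hypomorphic_def
proof (intro allI impI, elim conjE)
  interpret T: tournament T by fact
  interpret T': tournament T' by fact
  fix h K assume "h \<le> 3" and K: "K \<subseteq> V" "finite K" "card K = h"
  then consider "card K = 0" | "card K = 1" | "card K = 2" | "card K = 3" by linarith
  then show "digraph_iso (with_proj T \<restriction> K) (with_proj T' \<restriction> K)"
  proof cases
    case 1
    then show ?thesis
      using K unfolding digraph_iso_induce_subgraph_iff by (auto simp: bij_betw_def)
  next
    case 2
    then obtain x where "K = {x}" by (auto simp: card_1_singleton_iff)
    then show ?thesis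
      using T.asym_parcs T'.asym_parcs unfolding digraph_iso_induce_subgraph_iff
      by (intro exI[of _ id]) (auto dest: asymD)
  next
    case 3
    then obtain x y where xy: "K = {x, y}" "x \<noteq> y" by (auto simp: card_2_iff)
    have irr: "(u, u) \<notin> parcs T" "(u, u) \<notin> parcs T'" for u
      using T.asym_parcs T'.asym_parcs by (auto dest: asymD)
    have tot: "((x, y) \<in> parcs T) \<noteq> ((y, x) \<in> parcs T)" "((x, y) \<in> parcs T') \<noteq> ((y, x) \<in> parcs T')"
      using T.exactly_one_arc[of x y] T'.exactly_one_arc[of x y] xy K assms(3,4) by auto
    show ?thesis
    proof (cases "(x, y) \<in> parcs T \<longleftrightarrow> (x, y) \<in> parcs T'")
      case True
      then show ?thesis
        using irr tot xy unfolding digraph_iso_induce_subgraph_iff by (intro exI[of _ id]) auto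
    next
      \<comment> \<open>The arcs are opposite, so swapping \<open>x\<close> and \<open>y\<close> is
        an isomorphism.\<close>
      case False
      then show ?thesis
        using irr tot xy unfolding digraph_iso_induce_subgraph_iff
        by (intro exI[of _ "id(x := y, y := x)"]) (auto simp: bij_betw_def inj_on_def)
    qed
  next
    case 4
    show ?thesis
    proof (cases "cyclic_triple T K")
      case True
      then obtain x y z where K1: "K = {x, y, z}"
        "(x, y) \<in> parcs T" "(y, z) \<in> parcs T" "(z, x) \<in> parcs T"
        unfolding T.cyclic_triple_iff by blast
      obtain x' y' z' where K2: "K = {x', y', z'}"
        "(x', y') \<in> parcs T'" "(y', z') \<in> parcs T'" "(z', x') \<in> parcs T'"
        using True cyclic[OF K(1) 4] T'.cyclic_triple_iff[of K] by blast
      have "distinct [x, y, z]" "distinct [x', y', z']"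
        using K1 K2 T.asym_parcs T'.asym_parcs by (auto dest: asymD)
      then have "digraph_iso (with_proj T \<restriction> {x, y, z}) (with_proj T' \<restriction> {x', y', z'})"
        using K1 K2 T.asym_parcs T'.asym_parcs by (intro digraph_iso_triple) auto
      then show ?thesis using K1 K2 by simp
    next
      case False
      obtain x y z where K1: "K = {x, y, z}" "distinct [x, y, z]"
        "(x, y) \<in> parcs T" "(y, z) \<in> parcs T" "(x, z) \<in> parcs T"
        using T.transitive_tripleE[of K] K 4 False assms(3) by blast
      obtain x' y' z' where K2: "K = {x', y', z'}" "distinct [x', y', z']"
        "(x', y') \<in> parcs T'" "(y', z') \<in> parcs T'" "(x', z') \<in> parcs T'"
        using T'.transitive_tripleE[of K] K 4 False cyclic[of K] assms(4) by blast
      have "digraph_iso (with_proj T \<restriction> {x, y, z}) (with_proj T' \<restriction> {x', y', z'})"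
        using K1 K2 T.asym_parcs T'.asym_parcs by (intro digraph_iso_triple) auto
      then show ?thesis using K1 K2 by simp
    qed
  qed
qed

text \<open>The coprimality assumptions concern \<open>(k - i) choose (3 - i)\<close> for
  \<open>i = 2\<close>, \<open>1\<close>, \<open>0\<close>; at \<open>i = 3\<close> it is 1. For
  \<open>m = 2\<close> constancy of \<open>g\<close> modulo \<open>m\<close> is too weak, as it does
  not separate -1 from 1, so the case \<open>i = 0\<close> is used to get \<open>g X = 0\<close>
  directly.\<close>

lemma c3_cong_imp_le_3_hypomorphic:
  fixes m :: nat
  assumes "tournament T" "tournament T'" "pverts T = V" "pverts T' = V" "finite V"
    and k: "3 \<le> k" "k + 3 \<le> card V"
    and "2 \<le> m" "coprime (k - 2) m" "coprime ((k - 1) choose 2) m"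
    and m: "3 \<le> m \<or> coprime (k choose 3) m"
    and c3: "\<forall>K \<subseteq> V. card K = k \<longrightarrow> [c3 (with_proj T \<restriction> K) = c3 (with_proj T' \<restriction> K)] (mod m)"
  shows "le_hypomorphic V 3 T T'"
proof (rule le_3_hypomorphicI[OF assms(1-4)])
  interpret T: tournament T by fact
  interpret T': tournament T' by fact
  define g :: "'a set \<Rightarrow> int" where "g X = of_bool (cyclic_triple T X) - of_bool (cyclic_triple T' X)" for X
  have sums: "[(\<Sum>X | X \<subseteq> K \<and> card X = 3. g X) = 0] (mod int m)" if "K \<subseteq> V" "card K = k" for K
  proof -
    have "finite K" using that \<open>finite V\<close> finite_subset by blast
    then have "(\<Sum>X | X \<subseteq> K \<and> card X = 3. g X) =
        int (c3 (with_proj T \<restriction> K)) - int (c3 (with_proj T' \<restriction> K))"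
      by (simp add: c3_induce g_def sum_subtractf)
    then show ?thesis
      using c3 that by (simp add: cong_diff_iff_cong_0 cong_int_iff)
  qed
  have small: "u = v" if "[u = v] (mod int m)" "\<bar>u - v\<bar> < int m" for u v
    using that zdvd_imp_le[of "int m" "\<bar>u - v\<bar>"] by (auto simp: cong_iff_dvd_diff)
  have coprimes: "coprime (int ((k - i) choose (3 - i))) (int m)" if "1 \<le> i" "i \<le> 3" for i
  proof -
    have "i = 1 \<or> i = 2 \<or> i = 3" using that by linarith
    then show ?thesis using assms(9,10) by auto
  qed
  fix X assume X: "X \<subseteq> V" "card X = 3"
  have "g X = 0"
  proof (cases "3 \<le> m")
    case True
    \<comment> \<open>Values in {-1, 0, 1} differ by at most 2, which is less than
      \<open>m\<close>.\<close>
    have const: "g X = g Y" if "Y \<subseteq> V" "card Y = 3" for Y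
    proof (rule small)
      show "[g X = g Y] (mod int m)"
        using subset_sums_cong_const[OF \<open>finite V\<close> k(1) k(2) coprimes sums] X that by blast
    qed (use True in \<open>auto simp: g_def\<close>)
    obtain Y where Y: "Y \<subseteq> V" "card Y = 3" "\<not> cyclic_triple T Y"
      using T.exists_noncyclic_triple assms(3) k by auto
    obtain Z where Z: "Z \<subseteq> V" "card Z = 3" "\<not> cyclic_triple T' Z"
      using T'.exists_noncyclic_triple assms(4) k by auto
    \<comment> \<open>The common value of \<open>g\<close> is nonpositive because of
      \<open>Y\<close> and nonnegative because of \<open>Z\<close>.\<close>
    have "g Y \<le> 0" "g Z \<ge> 0" using Y Z by (auto simp: g_def)
    then show ?thesis using const[OF Y(1,2)] const[OF Z(1,2)] by simp
  next
    case False
    have "coprime (int ((k - i) choose (3 - i))) (int m)" if "i \<le> 3" for i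
      using coprimes[of i] that m False by (cases "i = 0") auto
    then have "[g X = 0] (mod int m)"
      using subset_sums_cong_0[OF \<open>finite V\<close> k(1) k(2) _ sums] X by blast
    then show ?thesis
      by (rule small) (use assms(8) in \<open>auto simp: g_def\<close>)
  qed
  then show "cyclic_triple T X \<longleftrightarrow> cyclic_triple T' X"
    by (auto simp: g_def split: if_splits)
qed

section \<open>Arithmetic of the binomials and the three parts\<close>

text \<open>The prime \<open>p\<close> divides neither \<open>k - 1\<close> nor
  \<open>k - 2\<close>, hence not their product, which is twice the binomial.\<close>

lemma coprime_choose_2:
  assumes "prime p" "3 \<le> k" "\<not> [k = 1] (mod p)" "\<not> [k = 2] (mod p)"
  shows "coprime (k - 2) p" "coprime ((k - 1) choose 2) p"
proof -
  have nd: "\<not> p dvd k - 1" "\<not> p dvd k - 2"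
    using assms by (auto simp: cong_altdef_nat)
  then show "coprime (k - 2) p"
    using assms(1) prime_imp_coprime coprime_commute by blast
  have "2 * ((k - 1) choose 2) = (k - 1) * (k - 2)"
    using times_binomial_minus1_eq[of 2 "k - 1"] by (simp add: numeral_2_eq_2)
  then have "\<not> p dvd (k - 1) choose 2"
    using nd assms(1) by (metis dvd_mult prime_dvd_mult_iff)
  then show "coprime ((k - 1) choose 2) p"
    using assms(1) prime_imp_coprime coprime_commute by blast
qed

text \<open>These are the three coprimality conditions for the modulus 2. With
  \<open>k = 4 * j + 3\<close>, the factor 2 of \<open>k - 1\<close> is exactly what the binomial
  divides out.\<close>

lemma odd_choose_mod_4:
  assumes "[k = 3] (mod 4)"
  shows "odd (k - 2)" "odd ((k - 1) choose 2)" "odd (k choose 3)"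
proof -
  obtain j where j: "k = 4 * j + 3"
    using assms mult_div_mod_eq[of 4 k] by (simp add: cong_def) metis
  show "odd (k - 2)" using j by simp
  have "2 * ((k - 1) choose 2) = (k - 1) * (k - 2)"
    using times_binomial_minus1_eq[of 2 "k - 1"] by (simp add: numeral_2_eq_2)
  then have "2 * ((k - 1) choose 2) = 2 * ((2 * j + 1) * (4 * j + 1))"
    using j by simp
  then have c2: "(k - 1) choose 2 = (2 * j + 1) * (4 * j + 1)" by linarith
  then show odd2: "odd ((k - 1) choose 2)" by simp
  have "3 * (k choose 3) = k * ((k - 1) choose 2)"
    using times_binomial_minus1_eq[of 3 k] by simp
  then have "odd (3 * (k choose 3))" using odd2 j by simp
  then show "odd (k choose 3)" by simp
qed

theorem theorem5p2:
  fixes T T' :: "'a pair_pre_digraph" and V :: "'a set" and v p k :: nat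
  assumes "tournament T" and "tournament T'"
    and "pverts T = V" and "pverts T' = V"
    and "finite V" and "card V = v"
    and "prime p" and "3 \<le> k" and "k \<le> v - 3"
  shows
    "((\<forall>K \<subseteq> V. card K = k \<longrightarrow> c3 (with_proj T \<restriction> K) = c3 (with_proj T' \<restriction> K))
        \<longrightarrow> le_hypomorphic V 3 T T')
     \<and>
     (p \<ge> 5 \<and> \<not> [k = 1] (mod p) \<and> \<not> [k = 2] (mod p) \<and>
        (\<forall>K \<subseteq> V. card K = k \<longrightarrow> [c3 (with_proj T \<restriction> K) = c3 (with_proj T' \<restriction> K)] (mod p))
        \<longrightarrow> le_hypomorphic V 3 T T')
     \<and>
     ((p = 2 \<and> [k = 3] (mod 4) \<or> p = 3 \<and> 3 dvd k) \<and>
        (\<forall>K \<subseteq> V. card K = k \<longrightarrow> [c3 (with_proj T \<restriction> K) = c3 (with_proj T' \<restriction> K)] (mod p))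
        \<longrightarrow> le_hypomorphic V 3 T T')"
proof (intro conjI impI; (elim conjE)?)
  have k: "k + 3 \<le> card V" using assms by linarith
  note main = c3_cong_imp_le_3_hypomorphic[OF assms(1-5) \<open>3 \<le> k\<close> k]
  note odd_case = main[OF _ coprime_choose_2[OF _ \<open>3 \<le> k\<close>]]
  {
    assume eq: "\<forall>K \<subseteq> V. card K = k \<longrightarrow> c3 (with_proj T \<restriction> K) = c3 (with_proj T' \<restriction> K)"
    \<comment> \<open>Equality gives congruence modulo any \<open>q\<close>; for
      \<open>q > k\<close> the residue of \<open>k\<close> is \<open>k\<close> itself, and this is
      neither 1 nor 2.\<close>
    obtain q where q: "prime q" "k < q" using bigger_prime by blast
    then have "\<not> [k = 1] (mod q)" "\<not> [k = 2] (mod q)"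
      using \<open>3 \<le> k\<close> by (auto simp: cong_def)
    then show "le_hypomorphic V 3 T T'"
      using odd_case[of q] q eq \<open>3 \<le> k\<close> by auto
  next
    assume "5 \<le> p" "\<not> [k = 1] (mod p)" "\<not> [k = 2] (mod p)"
      "\<forall>K \<subseteq> V. card K = k \<longrightarrow> [c3 (with_proj T \<restriction> K) = c3 (with_proj T' \<restriction> K)] (mod p)"
    then show "le_hypomorphic V 3 T T'"
      using odd_case[of p] \<open>prime p\<close> by simp
  next
    assume c3: "\<forall>K \<subseteq> V. card K = k \<longrightarrow> [c3 (with_proj T \<restriction> K) = c3 (with_proj T' \<restriction> K)] (mod p)"
      and "p = 2 \<and> [k = 3] (mod 4) \<or> p = 3 \<and> 3 dvd k"
    from this(2) show "le_hypomorphic V 3 T T'"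
    proof (elim disjE conjE)
      assume "p = 2" "[k = 3] (mod 4)"
      then show ?thesis
        using main[of 2] odd_choose_mod_4[of k] c3 by simp
    next
      assume p: "p = 3" "3 dvd k"
      \<comment> \<open>Since \<open>k\<close> is 0 modulo 3, this case falls under the same
        criterion as \<open>p \<ge> 5\<close>.\<close>
      then have "\<not> [k = 1] (mod 3)" "\<not> [k = 2] (mod 3)"
        by (auto simp: cong_def)
      then show ?thesis
        using odd_case[of 3] p c3 \<open>prime p\<close> by simp
    qed
  }
qed

end
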